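(* Let $X$ and $Y$ be nonempty finite sets, let $G \subseteq \mathrm{Aut}(X)$ and $K \subseteq \mathrm{Aut}(Y)$ be subgroups, and let $T \colon G \to K$ be a group homomorphism such that $T(G)\subseteq K$ acts transitively on $Y$. Let $F$ be a map from $\mathbb{R}^X$ to $\mathbb{R}^Y$. Then $(F,T)$ is a linear GENEO from $(\mathbb{R}^X,G)$ to $(\mathbb{R}^Y,K)$ if and only if there exists a generalized $T$-permutant measure $\mu$ such that $F(\varphi)=\sum_{h\in X^Y}\mu(h)\,(\varphi\circ h)$ for every $\varphi\in\mathbb{R}^X$ and $\sum_{h\in X^Y}|\mu(h)|\le 1$.
   Context: For a finite set $Z$, $\mathbb{R}^Z$ is the space of all functions $Z\to\mathbb{R}$ with the uniform norm $\|\cdot\|_\infty$, and $\mathrm{Aut}(Z)$ is the group of all bijections $Z\to Z$ under composition, acting on $\mathbb{R}^Z$ by composition on the right. $X^Y$ is the (finite) set of all functions $Y\to X$. Linear GENEO: $(F,T)$, with $T\colon G\to K$ a group homomorphism and $F\colon\mathbb{R}^X\to\mathbb{R}^Y$, is a Group Equivariant Operator (GEO) from $(\mathbb{R}^X,G)$ to $(\mathbb{R}^Y,K)$ if $F(\varphi\circ g)=F(\varphi)\circ T(g)$ for all $\varphi\in\mathbb{R}^X$, $g\in G$. A GEO is a Group Equivariant Non-Expansive Operator (GENEO) if moreover $\|F(\varphi_1)-F(\varphi_2)\|_\infty\le\|\varphi_1-\varphi_2\|_\infty$ for all $\varphi_1,\varphi_2\in\mathbb{R}^X$. It is linear if $F$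 is a linear map. Generalized $T$-permutant measure: a finite signed measure $\mu$ on the power set of $X^Y$ that is invariant under the action of $G$ on $X^Y$ given by $(g,h)\mapsto g\circ h\circ T(g^{-1})$; equivalently, writing $\mu(h):=\mu(\{h\})$, $\mu(h)=\mu(g\circ h\circ T(g^{-1}))$ for all $g\in G$, $h\in X^Y$. *)

theory Defs
  imports Complex_Main "HOL-Library.Function_Algebras" "HOL-Library.Disjoint_Sets"
    "HOL-Algebra.Group_Action"
begin

text \<open>A nonempty finite set \<open>Z\<close> is a type \<open>'z\<close> of class \<open>finite\<close>, and the space of real functions
  on it is \<open>'z \<Rightarrow> real\<close>, whose additive structure is the pointwise one of \<open>Function_Algebras\<close>.\<close>

definition scale_fun :: "real \<Rightarrow> ('z \<Rightarrow> real) \<Rightarrow> ('z \<Rightarrow> real)" where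
  "scale_fun c \<phi> = (\<lambda>z. c * \<phi> z)"

definition sup_norm :: "('z::finite \<Rightarrow> real) \<Rightarrow> real" where
  "sup_norm \<phi> = Max (range (\<lambda>z. \<bar>\<phi> z\<bar>))"

text \<open>On \<open>UNIV\<close>, the extensionality condition in \<open>BijGroup\<close> is vacuous, so that the carrier
  consists of all bijections and multiplication is \<open>\<circ>\<close>.\<close>

abbreviation Aut :: "('z \<Rightarrow> 'z) monoid" where
  "Aut \<equiv> BijGroup UNIV"

definition geo ::
  "('x \<Rightarrow> 'x) set \<Rightarrow> ('y \<Rightarrow> 'y) set \<Rightarrow> (('x \<Rightarrow> real) \<Rightarrow> ('y \<Rightarrow> real)) \<Rightarrow> (('x \<Rightarrow> 'x) \<Rightarrow> ('y \<Rightarrow> 'y)) \<Rightarrow> bool"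
where
  "geo G K F T \<longleftrightarrow>
     T \<in> hom (Aut\<lparr>carrier := G\<rparr>) (Aut\<lparr>carrier := K\<rparr>) \<and>
     (\<forall>\<phi>. \<forall>g\<in>G. F (\<phi> \<circ> g) = F \<phi> \<circ> T g)"

definition geneo ::
  "('x::finite \<Rightarrow> 'x) set \<Rightarrow> ('y::finite \<Rightarrow> 'y) set \<Rightarrow>
   (('x \<Rightarrow> real) \<Rightarrow> ('y \<Rightarrow> real)) \<Rightarrow> (('x \<Rightarrow> 'x) \<Rightarrow> ('y \<Rightarrow> 'y)) \<Rightarrow> bool"
where
  "geneo G K F T \<longleftrightarrow>
     geo G K F T \<and> (\<forall>\<phi>\<^sub>1 \<phi>\<^sub>2. sup_norm (F \<phi>\<^sub>1 - F \<phi>\<^sub>2) \<le> sup_norm (\<phi>\<^sub>1 - \<phi>\<^sub>2))"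

definition linear_geneo ::
  "('x::finite \<Rightarrow> 'x) set \<Rightarrow> ('y::finite \<Rightarrow> 'y) set \<Rightarrow>
   (('x \<Rightarrow> real) \<Rightarrow> ('y \<Rightarrow> real)) \<Rightarrow> (('x \<Rightarrow> 'x) \<Rightarrow> ('y \<Rightarrow> 'y)) \<Rightarrow> bool"
where
  "linear_geneo G K F T \<longleftrightarrow> geneo G K F T \<and> Vector_Spaces.linear scale_fun scale_fun F"

text \<open>Finite signed measures on the power set of the type \<open>'a\<close>; finiteness is expressed by the
  value type \<open>real\<close>.\<close>

definition finite_signed_measure :: "('a set \<Rightarrow> real) \<Rightarrow> bool" where
  "finite_signed_measure \<mu> \<longleftrightarrow>
     \<mu> {} = 0 \<and>
     (\<forall>A :: nat \<Rightarrow> 'a set. disjoint_family A \<longrightarrow> (\<lambda>n. \<mu> (A n)) sums \<mu> (\<Union>n. A n))"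

definition conj_action ::
  "(('x \<Rightarrow> 'x) \<Rightarrow> ('y \<Rightarrow> 'y)) \<Rightarrow> ('x \<Rightarrow> 'x) \<Rightarrow> ('y \<Rightarrow> 'x) \<Rightarrow> ('y \<Rightarrow> 'x)"
where
  "conj_action T g h = g \<circ> h \<circ> T (inv\<^bsub>Aut\<^esub> g)"

definition generalized_permutant_measure ::
  "('x \<Rightarrow> 'x) set \<Rightarrow> (('x \<Rightarrow> 'x) \<Rightarrow> ('y \<Rightarrow> 'y)) \<Rightarrow> (('y \<Rightarrow> 'x) set \<Rightarrow> real) \<Rightarrow> bool"
where
  "generalized_permutant_measure G T \<mu> \<longleftrightarrow>
     finite_signed_measure \<mu> \<and> (\<forall>g\<in>G. \<forall>A. \<mu> (conj_action T g ` A) = \<mu> A)"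

end

theory Submission
  imports Defs "HOL-Library.FuncSet"
begin

text \<open>A linear \<open>F\<close> is given by the kernel \<open>B y x = F \<delta>\<^sub>x y\<close>. Equivariance reads
  \<open>B (T g y) (g x) = B y x\<close>, so transitivity makes the row sums \<open>p\<close> and \<open>n\<close> of the positive and
  the negative part of \<open>B\<close> independent of \<open>y\<close>, and testing non-expansivity against the signs of a
  row gives \<open>p + n \<le> 1\<close>. The product over \<open>y\<close> of the probability distributions \<open>B\<^sup>+ y / p\<close> is an
  invariant probability measure on \<open>X\<^sup>Y\<close> whose marginals are the factors, and likewise for \<open>B\<^sup>-\<close>.
  The measure representing \<open>F\<close> is \<open>p\<close> times the former minus \<open>n\<close> times the latter.\<close>

section \<open>Functions on finite types\<close>

lemma sum_fun_apply: "(\<Sum>i\<in>A. f i) y = (\<Sum>i\<in>A. f i y :: 'b::comm_monoid_add)"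
  by (induction A rule: infinite_finite_induct) auto

lemma abs_le_sup_norm: "\<bar>\<phi> z\<bar> \<le> sup_norm \<phi>"
  unfolding sup_norm_def by (rule Max_ge) auto

lemma sup_norm_le_iff: "sup_norm \<phi> \<le> c \<longleftrightarrow> (\<forall>z. \<bar>\<phi> z\<bar> \<le> c)"
  unfolding sup_norm_def by (subst Max_le_iff) auto

definition delta :: "'x \<Rightarrow> 'x \<Rightarrow> real" where
  "delta x = (\<lambda>z. if z = x then 1 else 0)"

lemma delta_expansion: "\<phi> = (\<Sum>x\<in>UNIV. scale_fun (\<phi> x) (delta x))"
  for \<phi> :: "'x::finite \<Rightarrow> real"
  by (simp add: fun_eq_iff sum_fun_apply scale_fun_def delta_def if_distrib cong: if_cong)

text \<open>Applied to \<open>delta (g x)\<close>, the equivariance of \<open>F\<close> thereby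
  becomes invariance of its kernel under moving row and column index together.\<close>

lemma delta_comp_bij: "bij g \<Longrightarrow> delta (g x) \<circ> g = delta x"
  by (auto simp: delta_def fun_eq_iff bij_def inj_eq)

lemma linear_scale_fun_kernel:
  fixes F :: "('x::finite \<Rightarrow> real) \<Rightarrow> ('y \<Rightarrow> real)"
  assumes "Vector_Spaces.linear scale_fun scale_fun F"
  shows "F \<phi> y = (\<Sum>x\<in>UNIV. \<phi> x * F (delta x) y)"
proof -
  interpret Vector_Spaces.linear scale_fun scale_fun F by fact
  have "F \<phi> = F (\<Sum>x\<in>UNIV. scale_fun (\<phi> x) (delta x))"
    using delta_expansion[of \<phi>] by simp
  also have "\<dots> = (\<Sum>x\<in>UNIV. scale_fun (\<phi> x) (F (delta x)))"
    by (simp add: sum scale)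
  finally show ?thesis
    by (simp add: sum_fun_apply scale_fun_def)
qed

lemma linear_scale_fun_sum_comp:
  fixes m :: "('y \<Rightarrow> 'x) \<Rightarrow> real"
  shows "Vector_Spaces.linear scale_fun scale_fun (\<lambda>\<phi>. \<Sum>h\<in>H. scale_fun (m h) (\<phi> \<circ> h))"
  by unfold_locales
    (auto simp: scale_fun_def fun_eq_iff sum_fun_apply algebra_simps sum.distrib sum_distrib_left)

text \<open>Each point lies in at most one member of a disjoint family, so its contributions form a
  series with at most one nonzero term; finitely many such series add up.\<close>

lemma finite_signed_measure_sum:
  fixes m :: "'a::finite \<Rightarrow> real"
  shows "finite_signed_measure (\<lambda>A. \<Sum>h\<in>A. m h)"
  unfolding finite_signed_measure_def
proof (intro conjI allI impI)
  fix A :: "nat \<Rightarrow> 'a set"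
  assume disj: "disjoint_family A"
  \<comment> \<open>With an index set independent of \<open>n\<close>, the series can be exchanged
    with the sum over points.\<close>
  have ind: "(\<Sum>h\<in>S. m h) = (\<Sum>h\<in>UNIV. if h \<in> S then m h else 0)" for S
    by (simp add: sum.If_cases)
  have "(\<lambda>n. if h \<in> A n then m h else 0) sums (if h \<in> (\<Union>n. A n) then m h else 0)" for h
  proof (cases "h \<in> (\<Union>n. A n)")
    case True
    then obtain k where k: "h \<in> A k" by blast
    have "(\<lambda>n. if h \<in> A n then m h else 0) = (\<lambda>n. if n = k then m h else 0)"
      using disj k by (auto simp: disjoint_family_on_def fun_eq_iff)
    then show ?thesis
      using True sums_single[of k "\<lambda>_. m h"] by simp
  qed auto
  then show "(\<lambda>n. \<Sum>h\<in>A n. m h) sums (\<Sum>h\<in>(\<Union>n. A n). m h)"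
    unfolding ind by (intro sums_sum)
qed auto

section \<open>Subgroups of the automorphism group\<close>

lemma mem_carrier_Aut: "f \<in> carrier Aut \<longleftrightarrow> bij f"
  by (simp add: BijGroup_def Bij_def)

lemma mult_Aut: "bij f \<Longrightarrow> bij g \<Longrightarrow> f \<otimes>\<^bsub>Aut\<^esub> g = f \<circ> g"
  by (auto simp: BijGroup_def Bij_def compose_def fun_eq_iff)

lemma one_Aut: "\<one>\<^bsub>Aut\<^esub> = id"
  by (auto simp: BijGroup_def)

lemma subgroup_Aut_bij: "subgroup G Aut \<Longrightarrow> g \<in> G \<Longrightarrow> bij g"
  by (simp add: subgroup.mem_carrier flip: mem_carrier_Aut)

lemma inv_Aut:
  assumes "bij g"
  shows "inv\<^bsub>Aut\<^esub> g = inv_into UNIV g"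
proof (rule group.inv_equality[OF group_BijGroup])
  show "inv_into UNIV g \<otimes>\<^bsub>Aut\<^esub> g = \<one>\<^bsub>Aut\<^esub>"
    using assms by (simp add: mult_Aut one_Aut bij_imp_bij_inv bij_is_inj)
qed (use assms in \<open>auto simp: mem_carrier_Aut bij_imp_bij_inv\<close>)

text \<open>Inverses in a subgroup agree with those of \<open>Aut\<close>, and a homomorphism
  preserves them. This brings \<open>conj_action\<close> into the form
  \<open>g \<circ> h \<circ> inv_into UNIV (T g)\<close>.\<close>

lemma hom_Aut_inv:
  assumes G: "subgroup G Aut" and K: "subgroup K Aut"
    and T: "T \<in> hom (Aut\<lparr>carrier := G\<rparr>) (Aut\<lparr>carrier := K\<rparr>)" and g: "g \<in> G"
  shows "T (inv\<^bsub>Aut\<^esub> g) = inv_into UNIV (T g)"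
proof -
  interpret AG: group "Aut\<lparr>carrier := G\<rparr>"
    using subgroup.subgroup_is_group[OF G group_BijGroup] .
  interpret AK: group "Aut\<lparr>carrier := K\<rparr>"
    using subgroup.subgroup_is_group[OF K group_BijGroup] .
  interpret group_hom "Aut\<lparr>carrier := G\<rparr>" "Aut\<lparr>carrier := K\<rparr>" T
    by unfold_locales (rule T)
  have Tg: "T g \<in> K"
    using hom_closed[of g] g by simp
  have "T (inv\<^bsub>Aut\<^esub> g) = inv\<^bsub>Aut\<lparr>carrier := K\<rparr>\<^esub> T g"
    using hom_inv[of g] g group.m_inv_consistent[OF group_BijGroup G g] by simp
  also have "\<dots> = inv_into UNIV (T g)"
    using group.m_inv_consistent[OF group_BijGroup K Tg] inv_Aut[OF subgroup_Aut_bij[OF K Tg]]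
    by simp
  finally show ?thesis .
qed

section \<open>Product measures of equivariant kernels\<close>

text \<open>For \<open>p = 0\<close> the value is \<open>0\<close>, which is the right one: a nonnegative kernel with vanishing
  row sums is zero.\<close>

definition product_weight :: "real \<Rightarrow> ('y::finite \<Rightarrow> 'x \<Rightarrow> real) \<Rightarrow> ('y \<Rightarrow> 'x) \<Rightarrow> real" where
  "product_weight p C h = p * (\<Prod>y\<in>UNIV. C y (h y) / p)"

text \<open>The maps with a prescribed value at \<open>y\<close> form a box, so for nonzero
  \<open>p\<close> the sum of products factors: coordinate \<open>y\<close> contributes
  \<open>C y x / p\<close>, every other one a normalized row sum, which is 1.\<close>

lemma product_weight_marginal:
  fixes C :: "'y::finite \<Rightarrow> 'x::finite \<Rightarrow> real"
  assumes nonneg: "\<And>y x. C y x \<ge> 0" and row: "\<And>y. (\<Sum>x\<in>UNIV. C y x) = p"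
  shows "(\<Sum>h | h y = x. product_weight p C h) = C y x"
proof (cases "p = 0")
  case True
  then have "C y x = 0"
    using row[of y] nonneg by (simp add: sum_nonneg_eq_0_iff)
  then show ?thesis
    by (simp add: product_weight_def True)
next
  case False
  define S where "S = (\<lambda>y'. if y' = y then {x} else UNIV)"
  have S: "{h. h y = x} = PiE UNIV S"
    by (auto simp: S_def Pi_iff PiE_UNIV_domain split: if_splits)
  have "(\<Sum>h | h y = x. \<Prod>y'\<in>UNIV. C y' (h y') / p) = (\<Prod>y'\<in>UNIV. \<Sum>x'\<in>S y'. C y' x' / p)"
    unfolding S by (rule prod_sum_PiE[symmetric]) auto
  also have "\<dots> = (\<Prod>y'\<in>UNIV. if y' = y then C y x / p else 1)"
    using False by (intro prod.cong) (auto simp: S_def row sum_divide_distrib[symmetric])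
  also have "\<dots> = C y x / p"
    by simp
  finally show ?thesis
    using False by (simp add: product_weight_def sum_distrib_left[symmetric])
qed

lemma product_weight_total:
  fixes C :: "'y::finite \<Rightarrow> 'x::finite \<Rightarrow> real"
  assumes row: "\<And>y. (\<Sum>x\<in>UNIV. C y x) = p"
  shows "(\<Sum>h\<in>UNIV. product_weight p C h) = p"
proof (cases "p = 0")
  case False
  have "(\<Sum>h\<in>UNIV. \<Prod>y\<in>UNIV. C y (h y) / p) = (\<Prod>y\<in>UNIV. \<Sum>x\<in>UNIV. C y x / p)"
    using prod_sum_PiE[of UNIV "\<lambda>_. UNIV" "\<lambda>y x. C y x / p"] by simp
  also have "\<dots> = 1"
    using False by (simp add: row sum_divide_distrib[symmetric])
  finally show ?thesis
    by (simp add: product_weight_def sum_distrib_left[symmetric])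
qed (simp add: product_weight_def)

lemma product_weight_nonneg:
  assumes "\<And>y x. C y x \<ge> 0" and "p \<ge> 0"
  shows "product_weight p C h \<ge> 0"
  unfolding product_weight_def using assms by (intro mult_nonneg_nonneg prod_nonneg) auto

text \<open>The factor of the conjugated map at \<open>t y\<close> is
  \<open>C (t y) (g (h y)) / p = C y (h y) / p\<close>, so conjugation only permutes the
  factors.\<close>

lemma product_weight_invariant:
  assumes "bij t" and equiv: "\<And>y x. C (t y) (g x) = C y x"
  shows "product_weight p C (g \<circ> h \<circ> inv_into UNIV t) = product_weight p C h"
proof -
  have "(\<Prod>y\<in>UNIV. C y ((g \<circ> h \<circ> inv_into UNIV t) y) / p) = (\<Prod>y\<in>UNIV. C (t y) ((g \<circ> h \<circ> inv_into UNIV t) (t y)) / p)"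
    by (rule prod.reindex_bij_betw[OF \<open>bij t\<close>, symmetric])
  also have "\<dots> = (\<Prod>y\<in>UNIV. C y (h y) / p)"
    using \<open>bij t\<close> by (simp add: equiv bij_is_inj)
  finally show ?thesis
    by (simp add: product_weight_def)
qed

text \<open>For \<open>g\<close> with \<open>T g y = y'\<close>, equivariance makes row
  \<open>y'\<close> a rearrangement of row \<open>y\<close> along \<open>g\<close>.\<close>

lemma equivariant_kernel_row_sum:
  fixes C :: "'y \<Rightarrow> 'x \<Rightarrow> real"
  assumes equiv: "\<And>g y x. g \<in> G \<Longrightarrow> C (T g y) (g x) = C y x"
    and bij: "\<And>g. g \<in> G \<Longrightarrow> bij g"
    and trans: "\<And>y y'. \<exists>g\<in>G. T g y = y'"
  shows "(\<Sum>x\<in>UNIV. C y x) = (\<Sum>x\<in>UNIV. C y' x)"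
proof -
  obtain g where g: "g \<in> G" "T g y = y'"
    using trans by blast
  have "(\<Sum>x\<in>UNIV. C y' x) = (\<Sum>x\<in>UNIV. C y' (g x))"
    by (rule sum.reindex_bij_betw[OF bij[OF g(1)], symmetric])
  then show ?thesis
    using equiv[OF g(1), of y] g(2) by simp
qed

text \<open>Serves to reindex sums over all maps and to pass from invariance on points to invariance
  on sets.\<close>

lemma bij_conj:
  assumes "bij g" and "bij t"
  shows "bij (\<lambda>h. g \<circ> h \<circ> inv_into UNIV t)"
proof (rule bijI')
  show "(g \<circ> h \<circ> inv_into UNIV t = g \<circ> h' \<circ> inv_into UNIV t) = (h = h')" for h h'
    using assms by (auto simp: fun_eq_iff bij_def inj_eq) (metis inv_f_f)
  show "\<exists>h. f = g \<circ> h \<circ> inv_into UNIV t" for f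
    using assms
    by (intro exI[of _ "inv_into UNIV g \<circ> f \<circ> t"]) (auto simp: fun_eq_iff bij_def surj_f_inv_f)
qed

section \<open>The representation theorem\<close>

lemma linear_geneo_imp_representation:
  fixes F :: "('x::finite \<Rightarrow> real) \<Rightarrow> ('y::finite \<Rightarrow> real)"
  assumes lin: "Vector_Spaces.linear scale_fun scale_fun F"
    and nonexp: "\<And>\<phi>\<^sub>1 \<phi>\<^sub>2. sup_norm (F \<phi>\<^sub>1 - F \<phi>\<^sub>2) \<le> sup_norm (\<phi>\<^sub>1 - \<phi>\<^sub>2)"
    and equivariant: "\<And>\<phi> g. g \<in> G \<Longrightarrow> F (\<phi> \<circ> g) = F \<phi> \<circ> T g"
    and bij: "\<And>g. g \<in> G \<Longrightarrow> bij g" and bijT: "\<And>g. g \<in> G \<Longrightarrow> bij (T g)"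
    and trans: "\<And>y y'. \<exists>g\<in>G. T g y = y'"
  obtains m :: "('y \<Rightarrow> 'x) \<Rightarrow> real"
  where "\<And>g h. g \<in> G \<Longrightarrow> m (g \<circ> h \<circ> inv_into UNIV (T g)) = m h"
    and "\<And>\<phi>. F \<phi> = (\<Sum>h\<in>UNIV. scale_fun (m h) (\<phi> \<circ> h))"
    and "(\<Sum>h\<in>UNIV. \<bar>m h\<bar>) \<le> 1"
proof -
  define B where "B y x = F (delta x) y" for y x
  define P where "P y x = max 0 (B y x)" for y x
  define N where "N y x = max 0 (- B y x)" for y x
  \<comment> \<open>\<open>undefined\<close> is an arbitrary base point of \<open>'y\<close>;
    \<open>P_row\<close> and \<open>N_row\<close> show that every other row has the same
    sum.\<close>
  define p where "p = (\<Sum>x\<in>UNIV. P undefined x)"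
  define n where "n = (\<Sum>x\<in>UNIV. N undefined x)"
  define m where "m h = product_weight p P h - product_weight n N h" for h
  have B: "F \<phi> y = (\<Sum>x\<in>UNIV. \<phi> x * B y x)" for \<phi> y
    unfolding B_def by (rule linear_scale_fun_kernel[OF lin])
  have B_equiv: "B (T g y) (g x) = B y x" if "g \<in> G" for g y x
    using fun_cong[OF equivariant[OF that, of "delta (g x)"], of y]
    by (simp add: B_def delta_comp_bij[OF bij[OF that]])
  have P_equiv: "P (T g y) (g x) = P y x" and N_equiv: "N (T g y) (g x) = N y x"
    if "g \<in> G" for g y x
    using B_equiv[OF that] by (simp_all add: P_def N_def)
  have P0: "P y x \<ge> 0" and N0: "N y x \<ge> 0" for y x
    by (simp_all add: P_def N_def)
  have P_row: "(\<Sum>x\<in>UNIV. P y x) = p" for y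
    unfolding p_def using equivariant_kernel_row_sum[OF P_equiv bij trans] .
  have N_row: "(\<Sum>x\<in>UNIV. N y x) = n" for y
    unfolding n_def using equivariant_kernel_row_sum[OF N_equiv bij trans] .
  have p0: "p \<ge> 0" and n0: "n \<ge> 0"
    by (simp_all add: p_def n_def P0 N0 sum_nonneg)
  \<comment> \<open>Entrywise \<open>P + N\<close> is the absolute value of \<open>B\<close>, so
    \<open>p + n\<close> is the l1 norm of the base row. The signs of that row, as a test function
    of norm at most 1, attain it, and \<open>F 0 = 0\<close> turns the difference in
    \<open>nonexp\<close> into this single value.\<close>
  have "p + n = (\<Sum>x\<in>UNIV. \<bar>B undefined x\<bar>)"
    unfolding p_def n_def sum.distrib[symmetric] by (intro sum.cong) (auto simp: P_def N_def)
  also have "\<dots> = F (\<lambda>x. sgn (B undefined x)) undefined"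
    by (simp add: B abs_sgn mult.commute)
  also have "\<dots> \<le> sup_norm (F (\<lambda>x. sgn (B undefined x)) - F 0)"
    using abs_le_sup_norm[of "F (\<lambda>x. sgn (B undefined x)) - F 0" undefined]
    by (simp add: B[of 0])
  also have "\<dots> \<le> sup_norm ((\<lambda>x. sgn (B undefined x)) - 0)"
    by (rule nonexp)
  also have "\<dots> \<le> 1"
    by (simp add: sup_norm_le_iff sgn_if)
  finally have pn: "p + n \<le> 1" .
  show thesis
  proof (rule that)
    fix g h assume g: "g \<in> G"
    show "m (g \<circ> h \<circ> inv_into UNIV (T g)) = m h"
      unfolding m_def
      by (simp only: product_weight_invariant[of "T g" P g, OF bijT[OF g] P_equiv[OF g]]
          product_weight_invariant[of "T g" N g, OF bijT[OF g] N_equiv[OF g]])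
  next
    fix \<phi>
    have "(\<Sum>h\<in>UNIV. m h * \<phi> (h y)) = F \<phi> y" for y
    proof -
      \<comment> \<open>Grouping the maps by their value at \<open>y\<close> leaves only the
        marginals of \<open>m\<close> at \<open>y\<close>, which are
        \<open>P y x - N y x = B y x\<close>.\<close>
      have "(\<Sum>h\<in>UNIV. m h * \<phi> (h y)) = (\<Sum>x\<in>UNIV. \<Sum>h | h y = x. m h * \<phi> (h y))"
        using sum.group[of UNIV UNIV "\<lambda>h. h y" "\<lambda>h. m h * \<phi> (h y)"] by simp
      also have "\<dots> = (\<Sum>x\<in>UNIV. (\<Sum>h | h y = x. m h) * \<phi> x)"
        by (simp add: sum_distrib_right)
      also have "\<dots> = (\<Sum>x\<in>UNIV. (P y x - N y x) * \<phi> x)"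
        by (simp add: m_def sum_subtractf product_weight_marginal P0 N0 P_row N_row)
      also have "\<dots> = F \<phi> y"
        unfolding B by (intro sum.cong) (auto simp: P_def N_def max_def)
      finally show ?thesis .
    qed
    then show "F \<phi> = (\<Sum>h\<in>UNIV. scale_fun (m h) (\<phi> \<circ> h))"
      by (simp add: fun_eq_iff sum_fun_apply scale_fun_def)
  next
    \<comment> \<open>Both product weights are nonnegative, so their sum dominates the absolute
      value of their difference; its total is \<open>p + n\<close>.\<close>
    have "(\<Sum>h\<in>UNIV. \<bar>m h\<bar>) \<le> (\<Sum>h\<in>UNIV. product_weight p P h + product_weight n N h)"
    proof (rule sum_mono)
      fix h
      show "\<bar>m h\<bar> \<le> product_weight p P h + product_weight n N h"
        using product_weight_nonneg[of P p h, OF P0 p0] product_weight_nonneg[of N n h, OF N0 n0]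
        by (simp add: m_def)
    qed
    also have "\<dots> \<le> 1"
      using pn by (simp add: sum.distrib product_weight_total P_row N_row)
    finally show "(\<Sum>h\<in>UNIV. \<bar>m h\<bar>) \<le> 1" .
  qed
qed

text \<open>At each point the difference of the images is a combination of values of
  \<open>\<phi>\<^sub>1 - \<phi>\<^sub>2\<close> whose coefficients have total absolute value at
  most 1.\<close>

lemma sum_comp_nonexpansive:
  fixes m :: "('y::finite \<Rightarrow> 'x::finite) \<Rightarrow> real"
  assumes F: "\<And>\<phi>. F \<phi> = (\<Sum>h\<in>UNIV. scale_fun (m h) (\<phi> \<circ> h))"
    and m: "(\<Sum>h\<in>UNIV. \<bar>m h\<bar>) \<le> 1"
  shows "sup_norm (F \<phi>\<^sub>1 - F \<phi>\<^sub>2) \<le> sup_norm (\<phi>\<^sub>1 - \<phi>\<^sub>2)"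
  unfolding sup_norm_le_iff[of "F \<phi>\<^sub>1 - F \<phi>\<^sub>2"]
proof
  fix y
  let ?s = "sup_norm (\<phi>\<^sub>1 - \<phi>\<^sub>2)"
  have s0: "?s \<ge> 0"
    using order_trans[OF abs_ge_zero abs_le_sup_norm] .
  have "(F \<phi>\<^sub>1 - F \<phi>\<^sub>2) y = (\<Sum>h\<in>UNIV. m h * (\<phi>\<^sub>1 - \<phi>\<^sub>2) (h y))"
    by (simp add: F sum_fun_apply scale_fun_def sum_subtractf right_diff_distrib)
  also have "\<bar>\<dots>\<bar> \<le> (\<Sum>h\<in>UNIV. \<bar>m h\<bar> * \<bar>(\<phi>\<^sub>1 - \<phi>\<^sub>2) (h y)\<bar>)"
    unfolding abs_mult[symmetric] by (rule sum_abs)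
  also have "\<dots> \<le> (\<Sum>h\<in>UNIV. \<bar>m h\<bar> * ?s)"
    by (intro sum_mono mult_left_mono abs_le_sup_norm abs_ge_zero)
  also have "\<dots> \<le> ?s"
    using mult_right_mono[OF m s0] by (simp add: sum_distrib_right)
  finally show "\<bar>(F \<phi>\<^sub>1 - F \<phi>\<^sub>2) y\<bar> \<le> ?s" .
qed

lemma sum_comp_equivariant:
  fixes m :: "('y::finite \<Rightarrow> 'x::finite) \<Rightarrow> real"
  assumes F: "\<And>\<phi>. F \<phi> = (\<Sum>h\<in>UNIV. scale_fun (m h) (\<phi> \<circ> h))"
    and "bij g" and "bij t" and inv: "\<And>h. m (g \<circ> h \<circ> inv_into UNIV t) = m h"
  shows "F (\<phi> \<circ> g) = F \<phi> \<circ> t"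
proof
  fix y
  let ?c = "\<lambda>h. g \<circ> h \<circ> inv_into UNIV t"
  have "(F \<phi> \<circ> t) y = (\<Sum>h\<in>UNIV. m h * \<phi> (h (t y)))"
    by (simp add: F sum_fun_apply scale_fun_def)
  \<comment> \<open>Conjugation leaves the weights unchanged and replaces \<open>h (t y)\<close> by
    \<open>g (h y)\<close>, because \<open>inv_into UNIV t\<close> cancels \<open>t\<close>.\<close>
  also have "\<dots> = (\<Sum>h\<in>UNIV. m (?c h) * \<phi> (?c h (t y)))"
    by (rule sum.reindex_bij_betw[OF bij_conj[OF \<open>bij g\<close> \<open>bij t\<close>], symmetric])
  also have "\<dots> = F (\<phi> \<circ> g) y"
    using \<open>bij t\<close> by (simp only: inv) (simp add: F sum_fun_apply scale_fun_def bij_is_inj)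
  finally show "F (\<phi> \<circ> g) y = (F \<phi> \<circ> t) y" ..
qed

theorem theorem5p2:
  fixes G :: "('x::finite \<Rightarrow> 'x) set" and K :: "('y::finite \<Rightarrow> 'y) set"
    and T :: "('x \<Rightarrow> 'x) \<Rightarrow> ('y \<Rightarrow> 'y)"
    and F :: "('x \<Rightarrow> real) \<Rightarrow> ('y \<Rightarrow> real)"
  assumes "subgroup G Aut" and "subgroup K Aut"
    and "T \<in> hom (Aut\<lparr>carrier := G\<rparr>) (Aut\<lparr>carrier := K\<rparr>)"
    and "transitive_action (Aut\<lparr>carrier := T ` G\<rparr>) UNIV (\<lambda>k. k)"
  shows "linear_geneo G K F T \<longleftrightarrow>
    (\<exists>\<mu>. generalized_permutant_measure G T \<mu> \<and>
         (\<forall>\<phi>. F \<phi> = (\<Sum>h\<in>UNIV. scale_fun (\<mu> {h}) (\<phi> \<circ> h))) \<and>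
         (\<Sum>h\<in>UNIV. \<bar>\<mu> {h}\<bar>) \<le> 1)"
proof
  have bij: "bij g" if "g \<in> G" for g
    using subgroup_Aut_bij[OF assms(1) that] .
  have bijT: "bij (T g)" if "g \<in> G" for g
    using subgroup_Aut_bij[OF assms(2)] hom_in_carrier[OF assms(3)] that by simp
  have conj: "conj_action T g = (\<lambda>h. g \<circ> h \<circ> inv_into UNIV (T g))" if "g \<in> G" for g
    by (rule ext) (simp add: conj_action_def hom_Aut_inv[OF assms(1-3) that])
  have trans: "\<exists>g\<in>G. T g y = y'" for y y'
    using transitive_action.unique_orbit[OF assms(4), of y y'] by simp
  {
    assume "linear_geneo G K F T"
    then have lin: "Vector_Spaces.linear scale_fun scale_fun F"
      and nonexp: "\<And>\<phi>\<^sub>1 \<phi>\<^sub>2. sup_norm (F \<phi>\<^sub>1 - F \<phi>\<^sub>2) \<le> sup_norm (\<phi>\<^sub>1 - \<phi>\<^sub>2)"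
      and equiv: "\<And>\<phi> g. g \<in> G \<Longrightarrow> F (\<phi> \<circ> g) = F \<phi> \<circ> T g"
      by (auto simp: linear_geneo_def geneo_def geo_def)
    obtain m :: "('y \<Rightarrow> 'x) \<Rightarrow> real"
      where inv: "\<And>g h. g \<in> G \<Longrightarrow> m (g \<circ> h \<circ> inv_into UNIV (T g)) = m h"
        and F: "\<And>\<phi>. F \<phi> = (\<Sum>h\<in>UNIV. scale_fun (m h) (\<phi> \<circ> h))"
        and m: "(\<Sum>h\<in>UNIV. \<bar>m h\<bar>) \<le> 1"
      using linear_geneo_imp_representation[OF lin nonexp equiv bij bijT trans] by blast
    \<comment> \<open>Since conjugation is injective, invariance of the point weights carries over
      to every set.\<close>
    have "(\<Sum>h\<in>conj_action T g ` A. m h) = (\<Sum>h\<in>A. m h)" if g: "g \<in> G" for g A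
    proof -
      have "inj_on (conj_action T g) A"
        unfolding conj[OF g]
        using bij_is_inj[OF bij_conj[OF bij[OF g] bijT[OF g]]] by (rule inj_on_subset) simp
      then have "(\<Sum>h\<in>conj_action T g ` A. m h) = (\<Sum>h\<in>A. m (conj_action T g h))"
        by (simp add: sum.reindex)
      then show ?thesis
        by (simp only: conj[OF g] inv[OF g])
    qed
    then have "generalized_permutant_measure G T (\<lambda>A. \<Sum>h\<in>A. m h)"
      by (simp add: generalized_permutant_measure_def finite_signed_measure_sum)
    then show "\<exists>\<mu>. generalized_permutant_measure G T \<mu> \<and>
         (\<forall>\<phi>. F \<phi> = (\<Sum>h\<in>UNIV. scale_fun (\<mu> {h}) (\<phi> \<circ> h))) \<and>
         (\<Sum>h\<in>UNIV. \<bar>\<mu> {h}\<bar>) \<le> 1"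
      using F m by (intro exI[of _ "\<lambda>A. \<Sum>h\<in>A. m h"]) simp
  next
    assume "\<exists>\<mu>. generalized_permutant_measure G T \<mu> \<and>
         (\<forall>\<phi>. F \<phi> = (\<Sum>h\<in>UNIV. scale_fun (\<mu> {h}) (\<phi> \<circ> h))) \<and>
         (\<Sum>h\<in>UNIV. \<bar>\<mu> {h}\<bar>) \<le> 1"
    then obtain \<mu> where \<mu>: "generalized_permutant_measure G T \<mu>"
      and F: "\<And>\<phi>. F \<phi> = (\<Sum>h\<in>UNIV. scale_fun (\<mu> {h}) (\<phi> \<circ> h))"
      and le: "(\<Sum>h\<in>UNIV. \<bar>\<mu> {h}\<bar>) \<le> 1"
      by blast
    \<comment> \<open>Conversely, invariance on singletons gives back that of the point
      weights.\<close>
    have inv: "\<mu> {g \<circ> h \<circ> inv_into UNIV (T g)} = \<mu> {h}" if g: "g \<in> G" for g h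
    proof -
      have "\<mu> (conj_action T g ` {h}) = \<mu> {h}"
        using \<mu> g unfolding generalized_permutant_measure_def by blast
      then show ?thesis
        by (simp add: conj[OF g])
    qed
    have "F (\<phi> \<circ> g) = F \<phi> \<circ> T g" if "g \<in> G" for \<phi> g
      by (rule sum_comp_equivariant[where m = "\<lambda>h. \<mu> {h}", OF F bij[OF that] bijT[OF that] inv[OF that]])
    moreover have "sup_norm (F \<phi>\<^sub>1 - F \<phi>\<^sub>2) \<le> sup_norm (\<phi>\<^sub>1 - \<phi>\<^sub>2)" for \<phi>\<^sub>1 \<phi>\<^sub>2
      by (rule sum_comp_nonexpansive[where m = "\<lambda>h. \<mu> {h}", OF F le])
    moreover have "Vector_Spaces.linear scale_fun scale_fun F"
      using linear_scale_fun_sum_comp[where H = UNIV and m = "\<lambda>h. \<mu> {h}"] unfolding F[symmetric] .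
    ultimately show "linear_geneo G K F T"
      using assms(3) by (simp add: linear_geneo_def geneo_def geo_def)
  }
qed

end
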